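(* Let $(P_n)_{n\geq 0}$ be the Pell numbers, defined by $P_0=0$, $P_1=1$ and $P_n=2P_{n-1}+P_{n-2}$ for $n\geq 2$. Then $$P_{n+k}=P_{n+1}P_k+P_nP_{k-1}\qquad\text{for all integers } n\geq 0,\ k\geq 1,$$ $$P_{2n+1}=P_{n+1}^2+P_n^2\qquad\text{for all integers } n\geq 0,$$ $$P_{2n}=(P_{n+1}+P_{n-1})P_n\qquad\text{for all integers } n\geq 1.$$ *)

theory Defs
  imports Main
begin

fun pell :: "nat \<Rightarrow> nat" where
  "pell 0 = 0"
| "pell (Suc 0) = 1"
| "pell (Suc (Suc n)) = 2 * pell (Suc n) + pell n"

end

theory Submission
  imports Defs
begin

text \<open>
  All three identities are instances of the addition formula for Pell numbers, whose right-hand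
  side depends only on the sum \<open>n + k\<close>: when \<open>n\<close> grows by one and \<open>k\<close>
  shrinks by one, the recurrence applied to the second index and the recurrence applied to the
  first turn the two expressions into each other. Shifting the whole sum into the second index
  makes the first index 0, where the formula is trivial. Taking \<open>k = n + 1\<close> and
  \<open>k = n\<close> then gives the formulas for odd and even indices.
\<close>

text \<open>
  Stating the formula with \<open>Suc k\<close> avoids the truncated subtraction \<open>k - 1\<close>.
\<close>

lemma pell_add_Suc:
  "pell (n + Suc k) = pell (Suc n) * pell (Suc k) + pell n * pell k"
proof (induction n arbitrary: k)
  case 0
  show ?case by simp
next
  case (Suc n)
  have "pell (Suc n + Suc k) = pell (n + Suc (Suc k))"
    by simp
  also have "\<dots> = pell (Suc n) * pell (Suc (Suc k)) + pell n * pell (Suc k)"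
    by (rule Suc.IH)
  also have "\<dots> = pell (Suc (Suc n)) * pell (Suc k) + pell (Suc n) * pell k"
    by (simp add: algebra_simps)
  finally show ?case .
qed

lemma pell_add:
  assumes "k \<ge> 1"
  shows "pell (n + k) = pell (n + 1) * pell k + pell n * pell (k - 1)"
  using assms pell_add_Suc[of n "k - 1"] by simp

lemma pell_odd: "pell (2 * n + 1) = (pell (n + 1))\<^sup>2 + (pell n)\<^sup>2"
  using pell_add_Suc[of n n] by (simp add: power2_eq_square mult_2)

lemma pell_even:
  assumes "n \<ge> 1"
  shows "pell (2 * n) = (pell (n + 1) + pell (n - 1)) * pell n"
  using pell_add[OF assms, of n] by (simp only: mult_2 add_mult_distrib mult.commute[of "pell n" "pell (n - 1)"])

theorem corollary2:
  shows "(\<forall>(n::nat) (k::nat). k \<ge> 1 \<longrightarrow>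
            pell (n + k) = pell (n + 1) * pell k + pell n * pell (k - 1)) \<and>
         (\<forall>n::nat. pell (2 * n + 1) = (pell (n + 1))\<^sup>2 + (pell n)\<^sup>2) \<and>
         (\<forall>n::nat. n \<ge> 1 \<longrightarrow>
            pell (2 * n) = (pell (n + 1) + pell (n - 1)) * pell n)"
  using pell_add pell_odd pell_even by blast

end
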